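(* Fix $t>0$. Let $\{\alpha_k\}_{k\in\mathbb{N}}$ be real numbers none of which is a natural number, such that for all $k,m\in\mathbb{N}$ with $\alpha_k\neq\alpha_m$, $$\Gamma\!\left(-\tfrac{\alpha_m}{2}\right)\Gamma\!\left(\tfrac{1-\alpha_k}{2}\right)=\Gamma\!\left(-\tfrac{\alpha_k}{2}\right)\Gamma\!\left(\tfrac{1-\alpha_m}{2}\right).$$ Then the functions $\{\mathcal{H}_{\alpha_k}(x,t)\}_{k\in\mathbb{N}}$ form an orthogonal set on the interval $(0,\infty)$ with weight function $e^{-\frac{x^2}{2t}}$, i.e. $\int_0^\infty \mathcal{H}_{\alpha_k}(x,t)\mathcal{H}_{\alpha_m}(x,t)e^{-\frac{x^2}{2t}}\,dx=0$ whenever $\alpha_k\neq\alpha_m$.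
   Context: $U(a,z)$ denotes the standard (Whittaker) parabolic cylinder function (Abramowitz–Stegun, Ch. 19), and $D_\nu(z)=U(-\nu-\tfrac12,z)$. For $\alpha\in\mathbb{R}$, $t>0$, $x\in\mathbb{R}$, the power-normalised parabolic cylinder function is $$\mathcal{H}_\alpha(x,t)=t^{\frac{\alpha}{2}}e^{\frac{x^2}{4t}}D_\alpha\!\left(\tfrac{x}{\sqrt t}\right)=t^{\frac{\alpha}{2}}e^{\frac{x^2}{4t}}U\!\left(-\alpha-\tfrac12,\tfrac{x}{\sqrt t}\right).$$ *)

theory Defs
  imports "HOL-Analysis.Analysis"
begin

definition kummerM :: "real \<Rightarrow> real \<Rightarrow> real \<Rightarrow> real" where
  "kummerM a b z = (\<Sum>n. pochhammer a n / pochhammer b n * z ^ n / fact n)"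

text \<open>Standard parabolic cylinder function U(a,z) (A&S 19.2, 19.3; DLMF 12.4.1, 12.2.6, 12.2.7, 12.7.12, 12.7.13):
  U(a,z) = U(a,0) u1(a,z) + U'(a,0) u2(a,z), with
  U(a,0) = sqrt pi / (2^(a/2+1/4) Gamma(3/4+a/2)), U'(a,0) = - sqrt pi / (2^(a/2-1/4) Gamma(1/4+a/2)),
  u1 = exp(-z^2/4) M(a/2+1/4,1/2,z^2/2), u2 = z exp(-z^2/4) M(a/2+3/4,3/2,z^2/2).
  The reciprocal Gamma function rGamma (entire) is used, so poles of Gamma give the value 0.\<close>
definition pcfU :: "real \<Rightarrow> real \<Rightarrow> real" where
  "pcfU a z =
     sqrt pi * rGamma (3/4 + a/2) / 2 powr (a/2 + 1/4)
       * (exp (- (z^2) / 4) * kummerM (a/2 + 1/4) (1/2) (z^2 / 2))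
   - sqrt pi * rGamma (1/4 + a/2) / 2 powr (a/2 - 1/4)
       * (z * exp (- (z^2) / 4) * kummerM (a/2 + 3/4) (3/2) (z^2 / 2))"

definition pcfD :: "real \<Rightarrow> real \<Rightarrow> real" where
  "pcfD \<nu> z = pcfU (- \<nu> - 1/2) z"

definition pcfH :: "real \<Rightarrow> real \<Rightarrow> real \<Rightarrow> real" where
  "pcfH \<alpha> x t = t powr (\<alpha>/2) * exp (x^2 / (4*t)) * pcfD \<alpha> (x / sqrt t)"

end

theory Submission
  imports Defs
begin

text \<open>
  The functions \<open>F\<^sub>\<nu>(z) = exp (z\<^sup>2/4) D\<^sub>\<nu>(z)\<close> satisfy \<open>F\<^sub>\<nu>' = \<nu> F\<^bsub>\<nu>-1\<^esub>\<close> and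
  \<open>F\<^sub>\<nu>'' - z F\<^sub>\<nu>' + \<nu> F\<^sub>\<nu> = 0\<close>, so that the weighted Wronskian
  \<open>exp (- z\<^sup>2/2) (F\<^sub>\<nu> F\<^sub>\<mu>' - F\<^sub>\<mu> F\<^sub>\<nu>')\<close> has derivative \<open>(\<nu> - \<mu>) exp (- z\<^sup>2/2) F\<^sub>\<nu> F\<^sub>\<mu>\<close>.
  The Gamma condition says that this Wronskian vanishes at 0. It also vanishes at infinity: for \<open>\<nu> < 0\<close>,
  \<open>F\<^sub>\<nu>\<close> is a positive multiple of \<open>\<integral> u powr (- \<nu>/2 - 1) exp (- u - z sqrt (2u)) du\<close> over \<open>u > 0\<close>,
  hence bounded on the half-line, and integrating \<open>F\<^sub>\<nu>' = \<nu> F\<^bsub>\<nu>-1\<^esub>\<close> repeatedly gives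
  \<open>F\<^sub>\<nu>(z) = O(exp z)\<close> for every \<open>\<nu>\<close>.
\<close>

section \<open>Kummer's function\<close>

text \<open>Every factor \<open>(a + k) / (b + k)\<close> has absolute value at most
  \<open>\<bar>a\<bar> / b + 1\<close>, independently of k. A geometric bound lets an exponential
  series dominate Kummer's series for all z.\<close>

lemma abs_pochhammer_ratio_le:
  fixes a b :: real
  assumes "b > 0"
  shows "\<bar>pochhammer a n / pochhammer b n\<bar> \<le> (\<bar>a\<bar> / b + 1) ^ n"
proof (induction n)
  case (Suc n)
  have "\<bar>a + real n\<bar> \<le> \<bar>a\<bar> + real n"
    by simp
  also have "\<dots> \<le> \<bar>a\<bar> + real n + (\<bar>a\<bar> * real n / b + b)"
    using assms by simp
  also have "\<dots> = (\<bar>a\<bar> / b + 1) * (b + real n)"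
    using assms by (simp add: distrib_left distrib_right)
  finally have *: "\<bar>(a + real n) / (b + real n)\<bar> \<le> \<bar>a\<bar> / b + 1"
    using assms by (simp add: abs_divide pos_divide_le_eq)
  have "\<bar>pochhammer a (Suc n) / pochhammer b (Suc n)\<bar> =
      \<bar>(a + real n) / (b + real n)\<bar> * \<bar>pochhammer a n / pochhammer b n\<bar>"
    by (simp add: pochhammer_Suc abs_mult mult.commute)
  also have "\<dots> \<le> (\<bar>a\<bar> / b + 1) * (\<bar>a\<bar> / b + 1) ^ n"
    using assms by (intro mult_mono * Suc.IH) auto
  finally show ?case by simp
qed simp

lemma summable_kummerM:
  fixes a b z :: real
  assumes "b > 0"
  shows "summable (\<lambda>n. pochhammer a n / pochhammer b n * z ^ n / fact n)"
proof (rule summable_comparison_test')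
  show "summable (\<lambda>n. inverse (fact n) * ((\<bar>a\<bar> / b + 1) * \<bar>z\<bar>) ^ n)"
    by (rule summable_exp)
  show "norm (pochhammer a n / pochhammer b n * z ^ n / fact n)
      \<le> inverse (fact n) * ((\<bar>a\<bar> / b + 1) * \<bar>z\<bar>) ^ n" for n
  proof -
    have "\<bar>pochhammer a n / pochhammer b n\<bar> * \<bar>z\<bar> ^ n \<le> (\<bar>a\<bar> / b + 1) ^ n * \<bar>z\<bar> ^ n"
      by (intro mult_right_mono abs_pochhammer_ratio_le assms) auto
    then show ?thesis
      by (simp add: abs_mult power_abs power_mult_distrib divide_inverse mult_ac)
  qed
qed

lemma kummerM_sums:
  assumes "b > 0"
  shows "(\<lambda>n. pochhammer a n / pochhammer b n * z ^ n / fact n) sums kummerM a b z"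
  unfolding kummerM_def using summable_kummerM[OF assms] by (rule summable_sums)

lemma DERIV_kummerM:
  assumes "b > 0"
  shows "(kummerM a b has_real_derivative a / b * kummerM (a + 1) (b + 1) z) (at z)"
proof -
  define c where "c = (\<lambda>n. pochhammer a n / pochhammer b n / fact n)"
  have "summable (\<lambda>n. c n * y ^ n)" for y
    using summable_kummerM[OF assms, of a y] by (simp add: c_def)
  then have "((\<lambda>x. \<Sum>n. c n * x ^ n) has_real_derivative (\<Sum>n. diffs c n * z ^ n)) (at z)"
    by (rule termdiffs_strong_converges_everywhere)
  moreover have "(\<lambda>x. \<Sum>n. c n * x ^ n) = kummerM a b"
    by (simp add: kummerM_def c_def fun_eq_iff)
  \<comment> \<open>Splitting off the first factor of both Pochhammer symbols leaves the shifted
    parameters and the constant \<open>a / b\<close>.\<close>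
  moreover have "diffs c n * z ^ n =
      a / b * (pochhammer (a + 1) n / pochhammer (b + 1) n * z ^ n / fact n)" for n
    by (simp add: diffs_def c_def pochhammer_rec del: of_nat_Suc)
  ultimately show ?thesis
    using sums_unique[OF sums_mult[OF kummerM_sums[of "b + 1" "a + 1" z], of "a / b"]] assms
    by simp
qed

section \<open>Contiguous relations for Kummer's function\<close>

lemma sums_eq_shift:
  fixes f g :: "nat \<Rightarrow> real"
  assumes "f sums s" "g sums r" "f 0 = 0" "\<And>n. f (Suc n) = g n"
  shows "s = r"
  using assms sums_Suc_iff[of f s] sums_unique2[of g s r] by simp

text \<open>Constant terms cancel on the left, and the explicit factor z on the right pairs its n-th
  term with the left term of index n + 1. With \<open>b = 1/2\<close> this differentiates the odd
  solution.\<close>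

lemma kummerM_contiguous_lower:
  assumes "b > 0"
  shows "b * (kummerM a b z - kummerM a (b + 1) z) = z * a / (b + 1) * kummerM (a + 1) (b + 2) z"
proof (rule sums_eq_shift)
  show "(\<lambda>n. b * (pochhammer a n / pochhammer b n * z ^ n / fact n
      - pochhammer a n / pochhammer (b + 1) n * z ^ n / fact n)) sums
      (b * (kummerM a b z - kummerM a (b + 1) z))"
    using assms by (intro sums_mult sums_diff kummerM_sums) auto
  show "(\<lambda>n. z * a / (b + 1) * (pochhammer (a + 1) n / pochhammer (b + 2) n * z ^ n / fact n)) sums
      (z * a / (b + 1) * kummerM (a + 1) (b + 2) z)"
    using assms by (intro sums_mult kummerM_sums) auto
  fix n
  have pos: "pochhammer (b + 1) n > 0" "pochhammer (b + 2) n > 0"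
    using assms by (auto intro!: pochhammer_pos)
  have eq: "(b + 1) * pochhammer (b + 2) n = pochhammer (b + 1) n * (b + 1 + n)"
    using pochhammer_rec[of "b + 1" n] pochhammer_Suc[of "b + 1" n] by (simp add: add.assoc)
  \<comment> \<open>Here P is \<open>pochhammer (b + 1) n\<close> and s is \<open>b + 1 + n\<close>,
    so \<open>s - b\<close> is the n + 1 that cancels against the factorial.\<close>
  have "b / (b * P) - b / (P * s) = (s - b) / (P * s)" if "P > 0" "s > 0" for P s
    using assms that by (simp add: diff_divide_distrib)
  from this[OF pos(1), of "b + 1 + n"] have
    "b / pochhammer b (Suc n) - b / pochhammer (b + 1) (Suc n) = real (Suc n) / ((b + 1) * pochhammer (b + 2) n)"
    unfolding eq pochhammer_rec[of b] pochhammer_Suc[of "b + 1"] using assms by simp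
  then have "(b / pochhammer b (Suc n) - b / pochhammer (b + 1) (Suc n)) * (pochhammer a (Suc n) * z ^ Suc n / fact (Suc n))
     = real (Suc n) / ((b + 1) * pochhammer (b + 2) n) * (pochhammer a (Suc n) * z ^ Suc n / fact (Suc n))"
    by (rule arg_cong)
  also have "\<dots> = z * a / (b + 1) * (pochhammer (a + 1) n / pochhammer (b + 2) n * z ^ n / fact n)"
    by (simp add: pochhammer_rec[of a]  del: of_nat_Suc)
  finally show "b * (pochhammer a (Suc n) / pochhammer b (Suc n) * z ^ Suc n / fact (Suc n)
      - pochhammer a (Suc n) / pochhammer (b + 1) (Suc n) * z ^ Suc n / fact (Suc n)) =
      z * a / (b + 1) * (pochhammer (a + 1) n / pochhammer (b + 2) n * z ^ n / fact n)"
    by (simp add: left_diff_distrib right_diff_distrib diff_divide_distrib del: power_Suc fact_Suc)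
qed simp

text \<open>The Pochhammer symbols of a + 1 and a of length n + 1 share all but one factor each;
  these differ by n + 1, which cancels against the factorial.\<close>

lemma kummerM_contiguous_upper:
  assumes "b > 0"
  shows "kummerM (a + 1) b z - kummerM a b z = z / b * kummerM (a + 1) (b + 1) z"
proof (rule sums_eq_shift)
  show "(\<lambda>n. pochhammer (a + 1) n / pochhammer b n * z ^ n / fact n
      - pochhammer a n / pochhammer b n * z ^ n / fact n) sums (kummerM (a + 1) b z - kummerM a b z)"
    using assms by (intro sums_diff kummerM_sums)
  show "(\<lambda>n. z / b * (pochhammer (a + 1) n / pochhammer (b + 1) n * z ^ n / fact n)) sums
      (z / b * kummerM (a + 1) (b + 1) z)"
    using assms by (intro sums_mult kummerM_sums) auto
  fix n
  have "pochhammer (a + 1) (Suc n) - pochhammer a (Suc n) = real (Suc n) * pochhammer (a + 1) n"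
    unfolding pochhammer_Suc[of "a + 1"] pochhammer_rec[of a] by (simp add: algebra_simps)
  then have "(pochhammer (a + 1) (Suc n) - pochhammer a (Suc n)) * (z ^ Suc n / (pochhammer b (Suc n) * fact (Suc n)))
      = real (Suc n) * pochhammer (a + 1) n * (z ^ Suc n / (pochhammer b (Suc n) * fact (Suc n)))"
    by (rule arg_cong)
  also have "\<dots> = z / b * (pochhammer (a + 1) n / pochhammer (b + 1) n * z ^ n / fact n)"
    by (simp add: pochhammer_rec[of b] del: of_nat_Suc)
  finally show "pochhammer (a + 1) (Suc n) / pochhammer b (Suc n) * z ^ Suc n / fact (Suc n)
      - pochhammer a (Suc n) / pochhammer b (Suc n) * z ^ Suc n / fact (Suc n) =
      z / b * (pochhammer (a + 1) n / pochhammer (b + 1) n * z ^ n / fact n)"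
    by (simp add: left_diff_distrib diff_divide_distrib del: power_Suc fact_Suc)
qed simp

text \<open>Termwise, \<open>a * pochhammer (a + 1) n\<close> equals
  \<open>pochhammer a n * (a + n)\<close>, so the two numerators add up to
  \<open>pochhammer a n * (b + n)\<close>, and b + n moves the lower parameter back to b.\<close>

lemma kummerM_contiguous_mixed:
  assumes "b > 0"
  shows "a * kummerM (a + 1) (b + 1) z + (b - a) * kummerM a (b + 1) z = b * kummerM a b z"
proof (rule sums_unique2)
  show "(\<lambda>n. b * (pochhammer a n / pochhammer b n * z ^ n / fact n)) sums (b * kummerM a b z)"
    using assms by (intro sums_mult kummerM_sums)
  have "(\<lambda>n. a * (pochhammer (a + 1) n / pochhammer (b + 1) n * z ^ n / fact n)
      + (b - a) * (pochhammer a n / pochhammer (b + 1) n * z ^ n / fact n)) sums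
      (a * kummerM (a + 1) (b + 1) z + (b - a) * kummerM a (b + 1) z)"
    using assms by (intro sums_add sums_mult kummerM_sums) auto
  also have "(\<lambda>n. a * (pochhammer (a + 1) n / pochhammer (b + 1) n * z ^ n / fact n)
      + (b - a) * (pochhammer a n / pochhammer (b + 1) n * z ^ n / fact n)) =
      (\<lambda>n. b * (pochhammer a n / pochhammer b n * z ^ n / fact n))"
  proof
    fix n
    have a: "a * pochhammer (a + 1) n = pochhammer a n * (a + n)"
      using pochhammer_rec[of a n] pochhammer_Suc[of a n] by simp
    have b: "b * pochhammer (b + 1) n = pochhammer b n * (b + n)"
      using pochhammer_rec[of b n] pochhammer_Suc[of b n] by simp
    have pos: "pochhammer b n > 0" "pochhammer (b + 1) n > 0"
      using assms by (auto intro!: pochhammer_pos)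
    have "a * pochhammer (a + 1) n + (b - a) * pochhammer a n = pochhammer a n * (b + n)"
      unfolding a by (simp add: algebra_simps)
    moreover have "(b + n) / pochhammer (b + 1) n = b / pochhammer b n"
      using b pos by (simp add: field_simps)
    ultimately have "(a * pochhammer (a + 1) n + (b - a) * pochhammer a n) / pochhammer (b + 1) n * (z ^ n / fact n)
        = b * pochhammer a n / pochhammer b n * (z ^ n / fact n)"
      by (metis mult.commute times_divide_eq_right)
    then show "a * (pochhammer (a + 1) n / pochhammer (b + 1) n * z ^ n / fact n)
      + (b - a) * (pochhammer a n / pochhammer (b + 1) n * z ^ n / fact n) =
      b * (pochhammer a n / pochhammer b n * z ^ n / fact n)"
      by (simp add: add_divide_distrib distrib_right)
  qed
  finally show "(\<lambda>n. b * (pochhammer a n / pochhammer b n * z ^ n / fact n)) sums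
      (a * kummerM (a + 1) (b + 1) z + (b - a) * kummerM a (b + 1) z)" .
qed

section \<open>Integral representations\<close>

text \<open>Monotone convergence applied to the partial sums; it justifies integrating the cosh and
  sinh series term by term.\<close>

lemma has_integral_sums_nonneg:
  fixes f :: "nat \<Rightarrow> 'a::euclidean_space \<Rightarrow> real"
  assumes int: "\<And>k. (f k has_integral I k) S"
    and nonneg: "\<And>k x. x \<in> S \<Longrightarrow> f k x \<ge> 0"
    and sums: "\<And>x. x \<in> S \<Longrightarrow> (\<lambda>k. f k x) sums g x"
    and I: "I sums J"
  shows "(g has_integral J) S"
proof -
  define s where "s = (\<lambda>n x. \<Sum>k<n. f k x)"
  have s: "(s n has_integral (\<Sum>k<n. I k)) S" for n
    unfolding s_def by (intro has_integral_sum int) auto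
  then have s_int: "integral S (s n) = (\<Sum>k<n. I k)" for n
    by (rule integral_unique)
  have lim: "(\<lambda>n. integral S (s n)) \<longlonglongrightarrow> J"
    unfolding s_int using I by (simp add: sums_def)
  have "g integrable_on S \<and> (\<lambda>n. integral S (s n)) \<longlonglongrightarrow> integral S g"
  proof (rule monotone_convergence_increasing)
    show "s n integrable_on S" for n
      using s by blast
    show "s n x \<le> s (Suc n) x" if "x \<in> S" for n x
      using nonneg[OF that] by (simp add: s_def)
    show "(\<lambda>n. s n x) \<longlonglongrightarrow> g x" if "x \<in> S" for x
      using sums[OF that] by (simp add: s_def sums_def)
    show "bounded (range (\<lambda>n. integral S (s n)))"
      using lim by (intro convergent_imp_bounded)
  qed
  with lim show ?thesis
    using LIMSEQ_unique has_integral_integral by blast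
qed

lemma cosh_sums_even:
  fixes x :: real
  shows "(\<lambda>n. x ^ (2 * n) / fact (2 * n)) sums cosh x"
proof -
  have "(\<lambda>n. if even (2 * n) then x ^ (2 * n) /\<^sub>R fact (2 * n) else 0) sums cosh x"
  proof (rule sums_mono_reindex[THEN iffD2, OF _ _ cosh_converges])
    show "strict_mono (\<lambda>n::nat. 2 * n)"
      by (simp add: strict_mono_def)
    show "(if even n then x ^ n /\<^sub>R fact n else 0) = 0" if "n \<notin> range ((*) 2)" for n
      using that by (auto elim!: evenE)
  qed
  then show ?thesis by (simp add: field_simps)
qed

lemma sinh_sums_odd:
  fixes x :: real
  shows "(\<lambda>n. x ^ (2 * n + 1) / fact (2 * n + 1)) sums sinh x"
proof -
  have "(\<lambda>n. if even (2 * n + 1) then 0 else x ^ (2 * n + 1) /\<^sub>R fact (2 * n + 1)) sums sinh x"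
  proof (rule sums_mono_reindex[THEN iffD2, OF _ _ sinh_converges])
    show "strict_mono (\<lambda>n::nat. 2 * n + 1)"
      by (simp add: strict_mono_def)
    show "(if even n then 0 else x ^ n /\<^sub>R fact n) = 0" if "n \<notin> range (\<lambda>n. 2 * n + 1)" for n
      using that by (auto elim!: oddE)
  qed
  then show ?thesis by (simp add: field_simps)
qed

lemma Gamma_add_of_nat:
  fixes q :: real
  assumes "q > 0"
  shows "Gamma (q + n) = pochhammer q n * Gamma q"
proof -
  have "q \<notin> \<int>\<^sub>\<le>\<^sub>0"
    using assms by (auto elim!: nonpos_Ints_cases)
  then show ?thesis
    using Gamma_real_pos[OF assms] by (simp add: pochhammer_Gamma Gamma_eq_zero_iff)
qed

lemma pochhammer_three_halves: "pochhammer (3/2) n = (2 * n + 1) * pochhammer (1/2) n" for n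
  using pochhammer_rec[of "1/2::real" n] pochhammer_Suc[of "1/2::real" n] by (simp add: field_simps)

text \<open>The even powers of \<open>sqrt u\<close> turn each term into a Gamma integral at q + k,
  and \<open>fact_double\<close> splits (2k)! into \<open>4^k * pochhammer (1/2) k * fact k\<close>,
  which yields Kummer's coefficients.\<close>

lemma kummerM_half_cosh_integral:
  assumes "q > 0" "y \<ge> 0"
  shows "((\<lambda>u. u powr (q - 1) / exp u * cosh (2 * y * sqrt u)) has_integral
           Gamma q * kummerM q (1/2) (y\<^sup>2)) {0..}"
proof (rule has_integral_sums_nonneg)
  fix k :: nat
  have "((\<lambda>u. u powr (q + k - 1) / exp u * ((2 * y) ^ (2 * k) / fact (2 * k))) has_integral
      Gamma (q + k) * ((2 * y) ^ (2 * k) / fact (2 * k))) {0..}"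
    using assms by (intro has_integral_mult_left Gamma_integral_real) auto
  also have "Gamma (q + k) * ((2 * y) ^ (2 * k) / fact (2 * k)) =
      Gamma q * (pochhammer q k / pochhammer (1/2) k * (y\<^sup>2) ^ k / fact k)"
    unfolding Gamma_add_of_nat[OF assms(1)] fact_double
    by (simp add: power_mult_distrib power_mult)
  finally show "((\<lambda>u. u powr (q - 1) / exp u * ((2 * y * sqrt u) ^ (2 * k) / fact (2 * k)))
      has_integral Gamma q * (pochhammer q k / pochhammer (1/2) k * (y\<^sup>2) ^ k / fact k)) {0..}"
  proof (rule has_integral_eq[rotated])
    fix u :: real assume "u \<in> {0..}"
    \<comment> \<open>At u = 0 both sides are 0, because \<open>0 powr x = 0\<close> for every
      x.\<close>
    then have "u powr (q + k - 1) = u powr (q - 1) * sqrt u ^ (2 * k)"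
      by (cases "u = 0") (simp_all add: power_mult powr_add powr_diff powr_realpow)
    then show "u powr (q + k - 1) / exp u * ((2 * y) ^ (2 * k) / fact (2 * k)) =
        u powr (q - 1) / exp u * ((2 * y * sqrt u) ^ (2 * k) / fact (2 * k))"
      by (simp add: power_mult_distrib)
  qed
next
  show "(\<lambda>k. Gamma q * (pochhammer q k / pochhammer (1/2) k * (y\<^sup>2) ^ k / fact k)) sums
      (Gamma q * kummerM q (1/2) (y\<^sup>2))"
    by (intro sums_mult kummerM_sums) auto
  show "(\<lambda>k. u powr (q - 1) / exp u * ((2 * y * sqrt u) ^ (2 * k) / fact (2 * k))) sums
      (u powr (q - 1) / exp u * cosh (2 * y * sqrt u))" for u
    by (intro sums_mult cosh_sums_even)
qed auto

text \<open>As for cosh, but the odd power of \<open>sqrt u\<close> shifts the Gamma argument by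
  1/2, and (2k + 1)! brings in the Pochhammer symbol of 3/2.\<close>

lemma kummerM_three_halves_sinh_integral:
  assumes "q > 0" "y \<ge> 0"
  shows "((\<lambda>u. u powr (q - 1) / exp u * sinh (2 * y * sqrt u)) has_integral
           2 * y * Gamma (q + 1/2) * kummerM (q + 1/2) (3/2) (y\<^sup>2)) {0..}"
proof (rule has_integral_sums_nonneg)
  fix k :: nat
  have "((\<lambda>u. u powr (q + 1/2 + k - 1) / exp u * ((2 * y) ^ (2 * k + 1) / fact (2 * k + 1))) has_integral
      Gamma (q + 1/2 + k) * ((2 * y) ^ (2 * k + 1) / fact (2 * k + 1))) {0..}"
    using assms by (intro has_integral_mult_left Gamma_integral_real) auto
  also have "Gamma (q + 1/2 + k) * ((2 * y) ^ (2 * k + 1) / fact (2 * k + 1)) =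
      2 * y * Gamma (q + 1/2) * (pochhammer (q + 1/2) k / pochhammer (3/2) k * (y\<^sup>2) ^ k / fact k)"
  proof -
    have "fact (2 * k + 1) = 2 ^ (2 * k) * pochhammer (3/2) k * (fact k :: real)"
      using fact_double[of k, where 'a = real] by (simp add: pochhammer_three_halves)
    moreover have "Gamma (q + 1/2 + k) = pochhammer (q + 1/2) k * Gamma (q + 1/2)"
      using assms by (intro Gamma_add_of_nat) simp
    ultimately show ?thesis
      by (simp add: power_mult_distrib power_mult del: fact_Suc)
  qed
  finally show "((\<lambda>u. u powr (q - 1) / exp u * ((2 * y * sqrt u) ^ (2 * k + 1) / fact (2 * k + 1)))
      has_integral 2 * y * Gamma (q + 1/2) * (pochhammer (q + 1/2) k / pochhammer (3/2) k * (y\<^sup>2) ^ k / fact k)) {0..}"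
  proof (rule has_integral_eq[rotated])
    fix u :: real assume "u \<in> {0..}"
    have "u powr (q + 1/2 + k - 1) = u powr ((q - 1) + (1/2 + k))"
      by (simp add: algebra_simps)
    also have "\<dots> = u powr (q - 1) * sqrt u ^ (2 * k + 1)"
      using \<open>u \<in> {0..}\<close> unfolding powr_add
      by (cases "u = 0") (simp_all add: power_mult powr_realpow powr_half_sqrt)
    finally have "u powr (q + 1/2 + k - 1) = u powr (q - 1) * sqrt u ^ (2 * k + 1)" .
    then show "u powr (q + 1/2 + k - 1) / exp u * ((2 * y) ^ (2 * k + 1) / fact (2 * k + 1)) =
        u powr (q - 1) / exp u * ((2 * y * sqrt u) ^ (2 * k + 1) / fact (2 * k + 1))"
      by (simp only: power_mult_distrib) (simp del: fact_Suc)
  qed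
next
  show "(\<lambda>k. 2 * y * Gamma (q + 1/2) * (pochhammer (q + 1/2) k / pochhammer (3/2) k * (y\<^sup>2) ^ k / fact k)) sums
      (2 * y * Gamma (q + 1/2) * kummerM (q + 1/2) (3/2) (y\<^sup>2))"
    by (intro sums_mult kummerM_sums) auto
  show "(\<lambda>k. u powr (q - 1) / exp u * ((2 * y * sqrt u) ^ (2 * k + 1) / fact (2 * k + 1))) sums
      (u powr (q - 1) / exp u * sinh (2 * y * sqrt u))" for u
    by (intro sums_mult sinh_sums_odd)
  show "0 \<le> u powr (q - 1) / exp u * ((2 * y * sqrt u) ^ (2 * k + 1) / fact (2 * k + 1))"
    if "u \<in> {0..}" for k u
    using assms that by (intro mult_nonneg_nonneg divide_nonneg_nonneg zero_le_power) auto
qed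

text \<open>Since cosh - sinh is a decaying exponential, the difference integrates the Gamma
  integrand times a factor in [0, 1]. The growth of the two Kummer terms cancels.\<close>

lemma kummerM_difference_bounds:
  assumes "q > 0" "y \<ge> 0"
  shows "\<bar>Gamma q * kummerM q (1/2) (y\<^sup>2) - 2 * y * Gamma (q + 1/2) * kummerM (q + 1/2) (3/2) (y\<^sup>2)\<bar> \<le> Gamma q"
proof -
  let ?d = "Gamma q * kummerM q (1/2) (y\<^sup>2) - 2 * y * Gamma (q + 1/2) * kummerM (q + 1/2) (3/2) (y\<^sup>2)"
  have "((\<lambda>u. u powr (q - 1) / exp u * cosh (2 * y * sqrt u)
      - u powr (q - 1) / exp u * sinh (2 * y * sqrt u)) has_integral ?d) {0..}"
    by (intro has_integral_diff kummerM_half_cosh_integral kummerM_three_halves_sinh_integral assms)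
  then have int: "((\<lambda>u. u powr (q - 1) / exp u * exp (- (2 * y * sqrt u))) has_integral ?d) {0..}"
    by (simp add: right_diff_distrib diff_divide_distrib flip: cosh_minus_sinh)
  have "?d \<ge> 0"
    by (rule has_integral_nonneg[OF int]) auto
  moreover have "?d \<le> Gamma q"
  proof (rule has_integral_le[OF int Gamma_integral_real[OF assms(1)]])
    fix u :: real assume "u \<in> {0..}"
    then have "exp (- (2 * y * sqrt u)) \<le> 1"
      using assms by simp
    then show "u powr (q - 1) / exp u * exp (- (2 * y * sqrt u)) \<le> u powr (q - 1) / exp u"
      by (intro mult_left_le) auto
  qed
  ultimately show ?thesis by simp
qed

section \<open>Hermite functions of real degree\<close>

text \<open>This is \<open>exp (z^2/4) * pcfD \<nu> z\<close>; for natural \<nu> it is the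
  probabilists' Hermite polynomial.\<close>

definition hermite_fun :: "real \<Rightarrow> real \<Rightarrow> real" where
  "hermite_fun \<nu> z = sqrt pi * 2 powr (\<nu>/2) *
     (rGamma ((1 - \<nu>) / 2) * kummerM (- \<nu>/2) (1/2) (z\<^sup>2/2)
      - sqrt 2 * rGamma (- \<nu>/2) * (z * kummerM ((1 - \<nu>) / 2) (3/2) (z\<^sup>2/2)))"

lemma pcfD_eq_hermite_fun: "pcfD \<nu> z = exp (- (z\<^sup>2) / 4) * hermite_fun \<nu> z"
proof -
  have *: "(- \<nu> - 1/2) / 2 + 1/4 = - \<nu>/2" "(- \<nu> - 1/2) / 2 - 1/4 = - (\<nu>/2 + 1/2)"
    "3/4 + (- \<nu> - 1/2) / 2 = (1 - \<nu>) / 2" "1/4 + (- \<nu> - 1/2) / 2 = - \<nu>/2"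
    "(- \<nu> - 1/2) / 2 + 3/4 = (1 - \<nu>) / 2"
    by (simp_all add: field_simps)
  have p: "2 powr (- \<nu>/2) = inverse (2 powr (\<nu>/2))"
    using powr_minus[of 2 "\<nu>/2"] by simp
  have p': "2 powr (- (\<nu>/2 + 1/2)) = inverse (2 powr (\<nu>/2) * sqrt 2)"
    unfolding powr_minus powr_add by (simp add: powr_half_sqrt)
  have "x / inverse y = x * y" for x y :: real
    by (simp add: divide_inverse)
  then show ?thesis
    unfolding pcfD_def pcfU_def hermite_fun_def * p p'
    by (simp only: algebra_simps)
qed

section \<open>Derivatives and the Hermite equation\<close>

lemma DERIV_kummerM_even:
  "((\<lambda>z. kummerM q (1/2) (z\<^sup>2/2)) has_real_derivative 2 * q * (z * kummerM (q + 1) (3/2) (z\<^sup>2/2))) (at z)"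
proof -
  have "((\<lambda>z. kummerM q (1/2) (z\<^sup>2/2)) has_real_derivative q / (1/2) * kummerM (q + 1) (1/2 + 1) (z\<^sup>2/2) * z) (at z)"
    by (rule DERIV_chain2[OF DERIV_kummerM]) (auto intro!: derivative_eq_intros)
  then show ?thesis by (simp add: mult_ac)
qed

text \<open>The product rule gives Kummer functions with lower parameters 3/2 and 5/2, which
  \<open>kummerM_contiguous_lower\<close> combines into one with 1/2.\<close>

lemma DERIV_kummerM_odd:
  "((\<lambda>z. z * kummerM q (3/2) (z\<^sup>2/2)) has_real_derivative kummerM q (1/2) (z\<^sup>2/2)) (at z)"
proof -
  have "((\<lambda>z. kummerM q (3/2) (z\<^sup>2/2)) has_real_derivative q / (3/2) * kummerM (q + 1) (3/2 + 1) (z\<^sup>2/2) * z) (at z)"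
    by (rule DERIV_chain2[OF DERIV_kummerM]) (auto intro!: derivative_eq_intros)
  then have "((\<lambda>z. z * kummerM q (3/2) (z\<^sup>2/2)) has_real_derivative
      1 * kummerM q (3/2) (z\<^sup>2/2) + q / (3/2) * kummerM (q + 1) (3/2 + 1) (z\<^sup>2/2) * z * z) (at z)"
    by (intro DERIV_mult DERIV_ident)
  moreover have "kummerM q (3/2) (z\<^sup>2/2) + q / (3/2) * kummerM (q + 1) (3/2 + 1) (z\<^sup>2/2) * z * z
      = kummerM q (1/2) (z\<^sup>2/2)"
    using kummerM_contiguous_lower[of "1/2" q "z\<^sup>2/2"] by (simp add: power2_eq_square field_simps)
  ultimately show ?thesis by simp
qed

text \<open>Differentiation exchanges even and odd parts. The functional equation of
  \<open>rGamma\<close> at \<open>- \<nu>/2\<close> supplies the factor \<nu> and the coefficient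
  belonging to degree \<nu> - 1.\<close>

lemma DERIV_hermite_fun:
  "(hermite_fun \<nu> has_real_derivative \<nu> * hermite_fun (\<nu> - 1) z) (at z)"
proof -
  let ?E = "kummerM ((1 - \<nu>) / 2) (1/2) (z\<^sup>2/2)" and ?O = "z * kummerM (1 - \<nu>/2) (3/2) (z\<^sup>2/2)"
  have "(hermite_fun \<nu> has_real_derivative sqrt pi * 2 powr (\<nu>/2) *
     (rGamma ((1 - \<nu>) / 2) * (2 * (- \<nu>/2) * (z * kummerM (- \<nu>/2 + 1) (3/2) (z\<^sup>2/2)))
      - sqrt 2 * rGamma (- \<nu>/2) * ?E)) (at z)"
    unfolding hermite_fun_def[abs_def]
    by (intro DERIV_cmult DERIV_diff DERIV_kummerM_even DERIV_kummerM_odd)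
  also have "- \<nu>/2 + 1 = 1 - \<nu>/2" by simp
  also have "2 powr (\<nu>/2) = 2 powr ((\<nu> - 1) / 2) * sqrt 2"
    using powr_add[of 2 "(\<nu> - 1) / 2" "1/2"] by (simp add: powr_half_sqrt flip: add_divide_distrib)
  also have "rGamma (- \<nu>/2) = - \<nu>/2 * rGamma (1 - \<nu>/2)"
    using rGamma_plus1[of "- \<nu>/2"] by (simp add: add.commute)
  \<comment> \<open>The quotient \<open>(sqrt 2 * sqrt 2) / 2\<close> is 1, kept unevaluated so that
    this step is pure ring algebra.\<close>
  also have "sqrt pi * (2 powr ((\<nu> - 1) / 2) * sqrt 2) *
     (rGamma ((1 - \<nu>) / 2) * (2 * (- \<nu>/2) * ?O) - sqrt 2 * (- \<nu>/2 * rGamma (1 - \<nu>/2)) * ?E) =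
     sqrt pi * 2 powr ((\<nu> - 1) / 2) * \<nu> *
      ((sqrt 2 * sqrt 2) / 2 * rGamma (1 - \<nu>/2) * ?E - sqrt 2 * rGamma ((1 - \<nu>) / 2) * ?O)"
    by (simp only: algebra_simps divide_inverse) simp
  also have "\<dots> = \<nu> * hermite_fun (\<nu> - 1) z"
  proof -
    have "(1 - (\<nu> - 1)) / 2 = 1 - \<nu>/2" "- (\<nu> - 1) / 2 = (1 - \<nu>) / 2" by (simp_all add: field_simps)
    then show ?thesis unfolding hermite_fun_def by (simp only:) simp
  qed
  finally show ?thesis .
qed

text \<open>This is Hermite's equation F'' - z F' + \<nu> F = 0, with derivatives written through
  lower degrees. The outer factor \<nu> stays because F' determines only
  \<open>\<nu> * hermite_fun (\<nu> - 1)\<close>.\<close>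

lemma hermite_fun_recurrence:
  "\<nu> * ((\<nu> - 1) * hermite_fun (\<nu> - 2) z - z * hermite_fun (\<nu> - 1) z + hermite_fun \<nu> z) = 0"
proof -
  define c where "c = sqrt pi * 2 powr (\<nu>/2)"
  define A where "A = c * rGamma ((1 - \<nu>) / 2)"
  define B where "B = c * (sqrt 2 * rGamma (- \<nu>/2))"
  define E where "E = (\<lambda>q z::real. kummerM q (1/2) (z\<^sup>2/2))"
  \<comment> \<open>\<open>O'\<close> is the odd solution; its prime does not mean a
    derivative.\<close>
  define O' where "O' = (\<lambda>q z::real. z * kummerM q (3/2) (z\<^sup>2/2))"
  \<comment> \<open>\<open>G\<close> is F' in terms of even and odd parts. Differentiating it gives
    a second expression for F'', to be equated with the one from lower degrees.\<close>
  define G where "G = (\<lambda>z. A * (- \<nu> * O' (- \<nu>/2 + 1) z) - B * E ((1 - \<nu>)/2) z)"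
  have H: "hermite_fun \<nu> z = A * E (- \<nu>/2) z - B * O' ((1 - \<nu>)/2) z" for z
    by (simp add: hermite_fun_def A_def B_def c_def E_def O'_def algebra_simps)
  have "(hermite_fun \<nu> has_real_derivative G z) (at z)" for z
  proof -
    have "((\<lambda>z. A * E (- \<nu>/2) z - B * O' ((1 - \<nu>)/2) z) has_real_derivative
        A * (2 * (- \<nu>/2) * O' (- \<nu>/2 + 1) z) - B * E ((1 - \<nu>)/2) z) (at z)"
      unfolding E_def O'_def
      by (intro DERIV_cmult DERIV_diff DERIV_kummerM_even DERIV_kummerM_odd)
    then show ?thesis by (simp add: H[abs_def] G_def)
  qed
  then have G: "\<nu> * hermite_fun (\<nu> - 1) z = G z" for z
    using DERIV_unique DERIV_hermite_fun by blast
  have "((\<lambda>z. \<nu> * hermite_fun (\<nu> - 1) z) has_real_derivative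
      A * (- \<nu> * E (- \<nu>/2 + 1) z) - B * (2 * ((1 - \<nu>)/2) * O' ((1 - \<nu>)/2 + 1) z)) (at z)"
    unfolding G G_def unfolding E_def O'_def
    by (intro DERIV_cmult DERIV_diff DERIV_kummerM_even DERIV_kummerM_odd)
  moreover have "((\<lambda>z. \<nu> * hermite_fun (\<nu> - 1) z) has_real_derivative
      \<nu> * ((\<nu> - 1) * hermite_fun (\<nu> - 1 - 1) z)) (at z)"
    by (intro DERIV_cmult DERIV_hermite_fun)
  ultimately have 2: "\<nu> * ((\<nu> - 1) * hermite_fun (\<nu> - 2) z) =
      A * (- \<nu> * E (- \<nu>/2 + 1) z) - B * (2 * ((1 - \<nu>)/2) * O' ((1 - \<nu>)/2 + 1) z)"
    using DERIV_unique by fastforce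
  have E: "E (- \<nu>/2 + 1) z - z * O' (- \<nu>/2 + 1) z = E (- \<nu>/2) z"
    using kummerM_contiguous_upper[of "1/2" "- \<nu>/2" "z\<^sup>2/2"]
    by (simp add: E_def O'_def power2_eq_square algebra_simps)
  have O: "2 * ((1 - \<nu>)/2) * O' ((1 - \<nu>)/2 + 1) z = z * E ((1 - \<nu>)/2) z - \<nu> * O' ((1 - \<nu>)/2) z"
    using arg_cong[OF kummerM_contiguous_mixed[of "1/2" "(1 - \<nu>)/2" "z\<^sup>2/2"], of "\<lambda>x. 2 * z * x"]
    by (simp add: E_def O'_def field_simps)
  have "\<nu> * ((\<nu> - 1) * hermite_fun (\<nu> - 2) z) - z * (\<nu> * hermite_fun (\<nu> - 1) z) + \<nu> * hermite_fun \<nu> z = 0"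
    unfolding 2 O G unfolding G_def H E[symmetric] by (simp add: algebra_simps)
  then show ?thesis by (simp add: algebra_simps)
qed

section \<open>Growth on the half-line\<close>

lemma hermite_fun_bounded_neg:
  assumes "\<nu> < 0" "z \<ge> 0"
  shows "\<bar>hermite_fun \<nu> z\<bar> \<le> sqrt pi * 2 powr (\<nu>/2) * rGamma ((1 - \<nu>) / 2)"
proof -
  define q where "q = - \<nu>/2"
  have q: "q > 0" "(1 - \<nu>) / 2 = q + 1/2"
    using assms by (simp_all add: q_def field_simps)
  have pos: "Gamma q > 0" "Gamma (q + 1/2) > 0"
    using q by (auto intro!: Gamma_real_pos)
  \<comment> \<open>This is the difference bounded by \<open>kummerM_difference_bounds\<close> at
    \<open>y = z / sqrt 2\<close>; multiplying by both reciprocal Gammas recovers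
    \<open>hermite_fun \<nu> z\<close> up to its prefactor.\<close>
  define d where "d = Gamma q * kummerM q (1/2) (z\<^sup>2/2) - sqrt 2 * z * Gamma (q + 1/2) * kummerM (q + 1/2) (3/2) (z\<^sup>2/2)"
  have d: "\<bar>d\<bar> \<le> Gamma q"
  proof -
    have *: "2 * (z / sqrt 2) = sqrt 2 * z" "(z / sqrt 2)\<^sup>2 = z\<^sup>2/2"
      by (simp_all add: power_divide field_simps)
    have "z / sqrt 2 \<ge> 0"
      using assms by simp
    from kummerM_difference_bounds[OF q(1) this] show ?thesis
      unfolding * d_def .
  qed
  have "hermite_fun \<nu> z = sqrt pi * 2 powr (\<nu>/2) * (rGamma (q + 1/2) * (rGamma q * d))"
    using pos unfolding hermite_fun_def q q_def[symmetric]
    by (simp add: d_def rGamma_inverse_Gamma field_simps)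
  also have "\<bar>\<dots>\<bar> = sqrt pi * 2 powr (\<nu>/2) * (rGamma (q + 1/2) * (rGamma q * \<bar>d\<bar>))"
    using pos by (simp add: abs_mult rGamma_inverse_Gamma)
  also have "\<dots> \<le> sqrt pi * 2 powr (\<nu>/2) * (rGamma (q + 1/2) * (rGamma q * Gamma q))"
    using pos d by (intro mult_left_mono) (auto simp: rGamma_inverse_Gamma)
  finally show ?thesis
    using pos unfolding q by (simp add: rGamma_inverse_Gamma)
qed

text \<open>Both \<open>C * exp z + f z\<close> and \<open>C * exp z - f z\<close> are
  nondecreasing. An exponential bound keeps its shape under integration, so only the constant
  changes.\<close>

lemma abs_le_exp_if_deriv_le_exp:
  fixes f f' :: "real \<Rightarrow> real"
  assumes deriv: "\<And>z. z \<ge> 0 \<Longrightarrow> (f has_real_derivative f' z) (at z)"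
    and bound: "\<And>z. z \<ge> 0 \<Longrightarrow> \<bar>f' z\<bar> \<le> C * exp z"
    and "z \<ge> 0"
  shows "\<bar>f z\<bar> \<le> (\<bar>f 0\<bar> + C) * exp z"
proof -
  have "C * exp 0 + s * f 0 \<le> C * exp z + s * f z" if "\<bar>s\<bar> = 1" for s
  proof (rule DERIV_nonneg_imp_nondecreasing[OF \<open>z \<ge> 0\<close>])
    fix x :: real assume "0 \<le> x"
    have "((\<lambda>x. C * exp x + s * f x) has_real_derivative C * exp x + s * f' x) (at x)"
      using deriv[OF \<open>0 \<le> x\<close>] by (auto intro!: derivative_eq_intros)
    moreover have "\<bar>s * f' x\<bar> \<le> C * exp x"
      using bound[OF \<open>0 \<le> x\<close>] that by (simp add: abs_mult)
    ultimately show "\<exists>y. ((\<lambda>x. C * exp x + s * f x) has_real_derivative y) (at x) \<and> y \<ge> 0"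
      by (intro exI conjI) auto
  qed
  from this[of 1] this[of "-1"] have "\<bar>f z\<bar> \<le> \<bar>f 0\<bar> + C * exp z"
    using bound[of 0] by simp
  also have "\<bar>f 0\<bar> \<le> \<bar>f 0\<bar> * exp z"
    using \<open>z \<ge> 0\<close> by (simp add: mult_le_cancel_left1)
  finally show ?thesis by (simp add: algebra_simps)
qed

text \<open>Induction on a natural number above \<nu>: each step passes to \<nu> - 1, whose bound
  controls the derivative, until the degree is negative.\<close>

lemma hermite_fun_exp_bound: "\<exists>C. \<forall>z\<ge>0. \<bar>hermite_fun \<nu> z\<bar> \<le> C * exp z"
proof -
  obtain n :: nat where "\<nu> < n"
    using reals_Archimedean2 by blast
  then show ?thesis
  proof (induction n arbitrary: \<nu>)
    case 0
    define C where "C = sqrt pi * 2 powr (\<nu>/2) * rGamma ((1 - \<nu>) / 2)"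
    have C: "\<bar>hermite_fun \<nu> z\<bar> \<le> C" if "z \<ge> 0" for z
      unfolding C_def using 0 that by (intro hermite_fun_bounded_neg) auto
    have "\<bar>hermite_fun \<nu> z\<bar> \<le> C * exp z" if "z \<ge> 0" for z
    proof -
      have "0 \<le> C" using C[of 0] by linarith
      then have "C \<le> C * exp z" using that by (simp add: mult_le_cancel_left1)
      with C[OF that] show ?thesis by simp
    qed
    then show ?case by blast
  next
    case (Suc n)
    then have "\<nu> - 1 < n" by simp
    from Suc.IH[OF this] obtain C where C: "\<bar>hermite_fun (\<nu> - 1) z\<bar> \<le> C * exp z" if "z \<ge> 0" for z
      by blast
    have "\<bar>\<nu> * hermite_fun (\<nu> - 1) z\<bar> \<le> \<bar>\<nu>\<bar> * C * exp z" if "z \<ge> 0" for z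
      using mult_left_mono[OF C[OF that], of "\<bar>\<nu>\<bar>"] by (simp add: abs_mult mult_ac)
    from abs_le_exp_if_deriv_le_exp[OF DERIV_hermite_fun this] show ?case
      by blast
  qed
qed

text \<open>The Gaussian absorbs both exponentials. The bound serves twice: for the Wronskian at
  infinity and as the dominating function of the integral.\<close>

lemma hermite_fun_weighted_product_bound:
  obtains C where "\<And>z. z \<ge> 0 \<Longrightarrow> \<bar>exp (- (z\<^sup>2) / 2) * (hermite_fun \<nu> z * hermite_fun \<mu> z)\<bar> \<le> C * exp (- z)"
proof -
  obtain A where A: "\<bar>hermite_fun \<nu> z\<bar> \<le> A * exp z" if "z \<ge> 0" for z
    using hermite_fun_exp_bound by blast
  obtain B where B: "\<bar>hermite_fun \<mu> z\<bar> \<le> B * exp z" if "z \<ge> 0" for z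
    using hermite_fun_exp_bound by blast
  have nonneg: "0 \<le> A" "0 \<le> B"
    using A[of 0] B[of 0] by auto
  have "\<bar>exp (- (z\<^sup>2) / 2) * (hermite_fun \<nu> z * hermite_fun \<mu> z)\<bar> \<le> A * B * exp (9/2) * exp (- z)"
    if "z \<ge> 0" for z
  proof -
    have "\<bar>exp (- (z\<^sup>2) / 2) * (hermite_fun \<nu> z * hermite_fun \<mu> z)\<bar> =
        exp (- (z\<^sup>2) / 2) * (\<bar>hermite_fun \<nu> z\<bar> * \<bar>hermite_fun \<mu> z\<bar>)"
      by (simp add: abs_mult)
    also have "\<dots> \<le> exp (- (z\<^sup>2) / 2) * ((A * exp z) * (B * exp z))"
      using nonneg by (intro mult_left_mono mult_mono A B that) auto
    also have "\<dots> = A * B * exp (- (z\<^sup>2) / 2 + z + z)"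
      unfolding exp_add by (simp only: mult_ac)
    also have "\<dots> \<le> A * B * exp (9/2 + - z)"
    proof -
      \<comment> \<open>Completing the square in \<open>- z^2/2 + 3 * z\<close> gives the maximum
        9/2.\<close>
      have "0 \<le> (z - 3)\<^sup>2" by simp
      then have "- (z\<^sup>2) / 2 + z + z \<le> 9/2 + - z"
        by (simp add: power2_eq_square algebra_simps)
      then show ?thesis
        using nonneg by (intro mult_left_mono) auto
    qed
    finally show ?thesis unfolding exp_add by (simp add: mult_ac)
  qed
  then show ?thesis using that by blast
qed

section \<open>The weighted Wronskian: derivative, limit at infinity, value at 0\<close>

definition weighted_wronskian :: "real \<Rightarrow> real \<Rightarrow> real \<Rightarrow> real" where
  "weighted_wronskian \<nu> \<mu> z = exp (- (z\<^sup>2) / 2) *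
     (\<mu> * (hermite_fun \<nu> z * hermite_fun (\<mu> - 1) z) - \<nu> * (hermite_fun \<mu> z * hermite_fun (\<nu> - 1) z))"

text \<open>\<open>\<mu> * hermite_fun (\<mu> - 1)\<close> stands for the derivative of
  \<open>hermite_fun \<mu>\<close>. The products of two first derivatives cancel, and Hermite's
  equation removes the second derivatives together with the terms from the weight.\<close>

lemma DERIV_weighted_wronskian:
  "(weighted_wronskian \<nu> \<mu> has_real_derivative
     (\<nu> - \<mu>) * (exp (- (z\<^sup>2) / 2) * (hermite_fun \<nu> z * hermite_fun \<mu> z))) (at z)"
proof -
  let ?F = hermite_fun
  define e where "e = exp (- (z\<^sup>2) / 2)"
  have "(weighted_wronskian \<nu> \<mu> has_real_derivative
     (- z * e) * (\<mu> * (?F \<nu> z * ?F (\<mu> - 1) z) - \<nu> * (?F \<mu> z * ?F (\<nu> - 1) z)) +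
     (\<mu> * (\<nu> * ?F (\<nu> - 1) z * ?F (\<mu> - 1) z + (\<mu> - 1) * ?F (\<mu> - 1 - 1) z * ?F \<nu> z)
      - \<nu> * (\<mu> * ?F (\<mu> - 1) z * ?F (\<nu> - 1) z + (\<nu> - 1) * ?F (\<nu> - 1 - 1) z * ?F \<mu> z)) * e) (at z)"
    unfolding weighted_wronskian_def[abs_def] e_def
    by (intro DERIV_mult DERIV_diff DERIV_cmult DERIV_hermite_fun)
       (auto intro!: derivative_eq_intros)
  \<comment> \<open>Regrouped so that each bracket is an instance of
    \<open>hermite_fun_recurrence\<close>.\<close>
  also have "(- z * e) * (\<mu> * (?F \<nu> z * ?F (\<mu> - 1) z) - \<nu> * (?F \<mu> z * ?F (\<nu> - 1) z)) +
     (\<mu> * (\<nu> * ?F (\<nu> - 1) z * ?F (\<mu> - 1) z + (\<mu> - 1) * ?F (\<mu> - 1 - 1) z * ?F \<nu> z)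
      - \<nu> * (\<mu> * ?F (\<mu> - 1) z * ?F (\<nu> - 1) z + (\<nu> - 1) * ?F (\<nu> - 1 - 1) z * ?F \<mu> z)) * e =
     e * (?F \<nu> z * (\<mu> * ((\<mu> - 1) * ?F (\<mu> - 2) z - z * ?F (\<mu> - 1) z + ?F \<mu> z))
        - ?F \<mu> z * (\<nu> * ((\<nu> - 1) * ?F (\<nu> - 2) z - z * ?F (\<nu> - 1) z + ?F \<nu> z)))
     + (\<nu> - \<mu>) * (e * (?F \<nu> z * ?F \<mu> z))"
    by (simp add: algebra_simps)
  also have "\<dots> = (\<nu> - \<mu>) * (e * (?F \<nu> z * ?F \<mu> z))"
    unfolding hermite_fun_recurrence by simp
  finally show ?thesis unfolding e_def .
qed

lemma weighted_wronskian_tendsto_0: "(weighted_wronskian \<nu> \<mu> \<longlongrightarrow> 0) at_top"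
proof -
  \<comment> \<open>Stated for arbitrary degrees, since the Wronskian pairs \<nu> with \<mu> - 1 and
    \<mu> with \<nu> - 1.\<close>
  have *: "((\<lambda>z. exp (- (z\<^sup>2) / 2) * (hermite_fun \<nu> z * hermite_fun \<mu> z)) \<longlongrightarrow> 0) at_top" for \<nu> \<mu>
  proof -
    obtain C where C: "\<And>z. z \<ge> 0 \<Longrightarrow> \<bar>exp (- (z\<^sup>2) / 2) * (hermite_fun \<nu> z * hermite_fun \<mu> z)\<bar> \<le> C * exp (- z)"
      using hermite_fun_weighted_product_bound by blast
    have "((\<lambda>z::real. C * exp (- z)) \<longlongrightarrow> C * 0) at_top"
      by (intro tendsto_mult tendsto_const filterlim_compose[OF exp_at_bot]) (rule filterlim_uminus_at_bot_at_top)
    moreover have "eventually (\<lambda>z. norm (exp (- (z\<^sup>2) / 2) * (hermite_fun \<nu> z * hermite_fun \<mu> z))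
        \<le> C * exp (- z)) at_top"
      using eventually_ge_at_top[of 0] by eventually_elim (simp only: real_norm_def C)
    ultimately show ?thesis
      by (auto intro: Lim_null_comparison)
  qed
  have "((\<lambda>z. \<mu> * (exp (- (z\<^sup>2) / 2) * (hermite_fun \<nu> z * hermite_fun (\<mu> - 1) z))
      - \<nu> * (exp (- (z\<^sup>2) / 2) * (hermite_fun \<mu> z * hermite_fun (\<nu> - 1) z))) \<longlongrightarrow> \<mu> * 0 - \<nu> * 0) at_top"
    by (intro tendsto_diff tendsto_mult_left *)
  then show ?thesis
    unfolding weighted_wronskian_def by (simp add: right_diff_distrib mult.left_commute)
qed

lemma kummerM_0 [simp]: "kummerM a b 0 = 1"
  unfolding kummerM_def by (subst suminf_finite[of "{0}"]) auto

text \<open>At 0 the function and its derivative reduce to multiples of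
  \<open>rGamma ((1 - \<kappa>) / 2)\<close> and \<open>rGamma (- \<kappa>/2)\<close>, so the
  Wronskian is a multiple of the cross difference that the Gamma condition annihilates.\<close>

lemma weighted_wronskian_0:
  assumes "Gamma (- \<mu>/2) * Gamma ((1 - \<nu>) / 2) = Gamma (- \<nu>/2) * Gamma ((1 - \<mu>) / 2)"
  shows "weighted_wronskian \<nu> \<mu> 0 = 0"
proof -
  \<comment> \<open>Comparing two forms of the derivative at 0 yields
    \<open>rGamma (- \<kappa>/2)\<close> directly.\<close>
  have d: "\<kappa> * hermite_fun (\<kappa> - 1) 0 = - (sqrt pi * 2 powr (\<kappa>/2) * sqrt 2 * rGamma (- \<kappa>/2))" for \<kappa>
  proof -
    have "(hermite_fun \<kappa> has_real_derivative sqrt pi * 2 powr (\<kappa>/2) *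
       (rGamma ((1 - \<kappa>) / 2) * (2 * (- \<kappa>/2) * (0 * kummerM (- \<kappa>/2 + 1) (3/2) (0\<^sup>2/2)))
        - sqrt 2 * rGamma (- \<kappa>/2) * kummerM ((1 - \<kappa>) / 2) (1/2) (0\<^sup>2/2))) (at 0)"
      unfolding hermite_fun_def[abs_def]
      by (intro DERIV_cmult DERIV_diff DERIV_kummerM_even DERIV_kummerM_odd)
    from DERIV_unique[OF DERIV_hermite_fun this] show ?thesis by simp
  qed
  \<comment> \<open>\<open>rGamma x = inverse (Gamma x)\<close> includes the poles, where
    \<open>Gamma\<close> has value 0 and \<open>inverse 0 = 0\<close>.\<close>
  have r: "rGamma (- \<mu>/2) * rGamma ((1 - \<nu>) / 2) = rGamma (- \<nu>/2) * rGamma ((1 - \<mu>) / 2)"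
    using arg_cong[OF assms, of inverse] by (simp add: rGamma_inverse_Gamma)
  have h: "hermite_fun \<kappa> 0 = sqrt pi * 2 powr (\<kappa>/2) * rGamma ((1 - \<kappa>) / 2)" for \<kappa>
    by (simp add: hermite_fun_def)
  have "weighted_wronskian \<nu> \<mu> 0 =
      hermite_fun \<nu> 0 * (\<mu> * hermite_fun (\<mu> - 1) 0) - hermite_fun \<mu> 0 * (\<nu> * hermite_fun (\<nu> - 1) 0)"
    by (simp add: weighted_wronskian_def algebra_simps)
  also have "\<dots> = sqrt pi * sqrt pi * 2 powr (\<nu>/2) * 2 powr (\<mu>/2) * sqrt 2 *
      (rGamma (- \<nu>/2) * rGamma ((1 - \<mu>) / 2) - rGamma (- \<mu>/2) * rGamma ((1 - \<nu>) / 2))"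
    unfolding d unfolding h by (simp only: algebra_simps mult_minus_right)
  finally show ?thesis using r by simp
qed

section \<open>Orthogonality on the half-line\<close>

lemma hermite_fun_orthogonal:
  assumes "\<nu> \<noteq> \<mu>" "t > 0"
    and "Gamma (- \<mu>/2) * Gamma ((1 - \<nu>) / 2) = Gamma (- \<nu>/2) * Gamma ((1 - \<mu>) / 2)"
  shows "((\<lambda>x. exp (- ((x / sqrt t)\<^sup>2) / 2) * (hermite_fun \<nu> (x / sqrt t) * hermite_fun \<mu> (x / sqrt t)))
           has_integral 0) {0..}"
proof -
  define r where "r = sqrt t"
  have r: "r > 0" using assms by (simp add: r_def)
  define g where "g = (\<lambda>z. exp (- (z\<^sup>2) / 2) * (hermite_fun \<nu> z * hermite_fun \<mu> z))"
  \<comment> \<open>An antiderivative of the integrand: \<open>r\<close> offsets the inner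
    derivative of x / r, and division by \<nu> - \<mu> normalises the Wronskian's
    derivative.\<close>
  define W where "W = (\<lambda>x. r / (\<nu> - \<mu>) * weighted_wronskian \<nu> \<mu> (x / r))"
  have W': "(W has_real_derivative g (x / r)) (at x)" for x
  proof -
    have "((\<lambda>x. weighted_wronskian \<nu> \<mu> (x / r)) has_real_derivative (\<nu> - \<mu>) * g (x / r) * (1 / r)) (at x)"
      unfolding g_def by (rule DERIV_chain2[OF DERIV_weighted_wronskian]) (use r in \<open>auto intro!: derivative_eq_intros\<close>)
    from DERIV_cmult[OF this, of "r / (\<nu> - \<mu>)"] show ?thesis
      using assms r by (simp add: W_def)
  qed
  obtain C where C: "\<And>z. z \<ge> 0 \<Longrightarrow> \<bar>g z\<bar> \<le> C * exp (- z)"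
    unfolding g_def using hermite_fun_weighted_product_bound by blast
  have C0: "C \<ge> 0" using C[of 0] by simp
  have "((\<lambda>x. g (x / r)) has_integral 0) {0..}"
  \<comment> \<open>The integral is the limit of those over \<open>{0..real k}\<close>, each equal
    to \<open>W k - W 0\<close>.\<close>
  proof (rule has_integral_dominated_convergence)
    fix k :: nat
    have "((\<lambda>x. g (x / r)) has_integral (W k - W 0)) {0..real k}"
      by (rule fundamental_theorem_of_calculus)
         (use W' in \<open>auto simp flip: has_real_derivative_iff_has_vector_derivative intro: has_field_derivative_at_within\<close>)
    moreover have "{0..real k} \<subseteq> {0..}" by auto
    ultimately show "((\<lambda>x. if x \<in> {0..real k} then g (x / r) else 0) has_integral (W k - W 0)) {0..}"
      by (subst has_integral_restrict)
    show "\<forall>x\<in>{0..}. norm (if x \<in> {0..real k} then g (x / r) else 0) \<le> C * exp (- (1 / r) * x)"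
      using C r C0 by auto
  next
    show "(\<lambda>x. C * exp (- (1 / r) * x)) integrable_on {0..}"
      using r by (intro integrable_on_mult_right integrable_on_exp_minus_to_infinity) auto
    show "\<forall>x\<in>{0..}. (\<lambda>k. if x \<in> {0..real k} then g (x / r) else 0) \<longlonglongrightarrow> g (x / r)"
    proof
      fix x :: real assume "x \<in> {0..}"
      \<comment> \<open>From this index on x lies inside the cut-off, so the sequence is eventually
        constant.\<close>
      have "eventually (\<lambda>k. nat \<lceil>x\<rceil> \<le> k) sequentially"
        by (rule eventually_ge_at_top)
      then have "eventually (\<lambda>k. (if x \<in> {0..real k} then g (x / r) else 0) = g (x / r)) sequentially"
        by eventually_elim (use \<open>x \<in> {0..}\<close> in \<open>auto simp: nat_le_iff ceiling_le_iff\<close>)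
      then show "(\<lambda>k. if x \<in> {0..real k} then g (x / r) else 0) \<longlonglongrightarrow> g (x / r)"
        by (rule tendsto_eventually)
    qed
    have "filterlim (\<lambda>k. 1 / r * real k) at_top sequentially"
      using r by (intro filterlim_tendsto_pos_mult_at_top[OF tendsto_const] filterlim_real_sequentially) auto
    then have "filterlim (\<lambda>k. real k / r) at_top sequentially" by simp
    then have "(\<lambda>k. r / (\<nu> - \<mu>) * weighted_wronskian \<nu> \<mu> (real k / r) - W 0) \<longlonglongrightarrow> r / (\<nu> - \<mu>) * 0 - W 0"
      by (intro tendsto_intros filterlim_compose[OF weighted_wronskian_tendsto_0])
    moreover have W0: "W 0 = 0"
      using weighted_wronskian_0[OF assms(3)] by (simp add: W_def)
    ultimately show "(\<lambda>k. W (real k) - W 0) \<longlonglongrightarrow> 0"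
      unfolding W0 unfolding W_def by simp
  qed
  then show ?thesis unfolding g_def r_def .
qed

theorem theorem1:
  fixes t :: real and \<alpha> :: "nat \<Rightarrow> real"
  assumes "t > 0"
    and "\<And>k. \<alpha> k \<notin> \<nat>"
    and "\<And>k m. \<alpha> k \<noteq> \<alpha> m \<Longrightarrow>
           Gamma (- \<alpha> m / 2) * Gamma ((1 - \<alpha> k) / 2) = Gamma (- \<alpha> k / 2) * Gamma ((1 - \<alpha> m) / 2)"
  shows "\<And>k m. \<alpha> k \<noteq> \<alpha> m \<Longrightarrow>
           ((\<lambda>x. pcfH (\<alpha> k) x t * pcfH (\<alpha> m) x t * exp (- (x^2) / (2*t))) has_integral 0) {0<..}"
proof -
  fix k m assume neq: "\<alpha> k \<noteq> \<alpha> m"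
  let ?c = "t powr (\<alpha> k / 2) * t powr (\<alpha> m / 2)"
  have H: "pcfH \<nu> x t = t powr (\<nu>/2) * hermite_fun \<nu> (x / sqrt t)" for \<nu> x
  proof -
    \<comment> \<open>The normalising exponential in \<open>pcfH\<close> cancels the Gaussian factor
      of \<open>pcfD\<close>.\<close>
    have "exp (x\<^sup>2 / (4 * t)) * exp (- ((x / sqrt t)\<^sup>2) / 4) = 1"
      using \<open>t > 0\<close> by (simp add: power_divide field_simps flip: exp_add)
    then show ?thesis
      by (simp add: pcfH_def pcfD_eq_hermite_fun flip: mult.assoc)
  qed
  have e: "- (x\<^sup>2) / (2 * t) = - ((x / sqrt t)\<^sup>2) / 2" for x
    using \<open>t > 0\<close> by (simp add: power_divide field_simps)
  have "((\<lambda>x. ?c * (exp (- ((x / sqrt t)\<^sup>2) / 2) *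
      (hermite_fun (\<alpha> k) (x / sqrt t) * hermite_fun (\<alpha> m) (x / sqrt t)))) has_integral ?c * 0) {0..}"
    by (intro has_integral_mult_right hermite_fun_orthogonal neq assms)
  then have "((\<lambda>x. pcfH (\<alpha> k) x t * pcfH (\<alpha> m) x t * exp (- (x\<^sup>2) / (2 * t))) has_integral 0) {0..}"
    unfolding H e by (simp add: mult_ac)
  \<comment> \<open>The closed and open half-lines differ only in the point 0.\<close>
  moreover have "negligible {x \<in> {0..} - {0<..}. f x \<noteq> 0}" "negligible {x \<in> {0<..} - {0..}. f x \<noteq> 0}"
    for f :: "real \<Rightarrow> real"
    by (rule negligible_subset[OF negligible_sing[of 0]]; force)+
  ultimately show "((\<lambda>x. pcfH (\<alpha> k) x t * pcfH (\<alpha> m) x t * exp (- (x\<^sup>2) / (2 * t))) has_integral 0) {0<..}"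
    using has_integral_spike_set_eq by blast
qed

end
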